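(* Let an instance of the network design setting ($\mathcal{N}=(N,E)$, costs $b,c$, arc lengths $d$, O/D pairs $W$, demands $g$, private utilities $u$, and $\alpha\in[0,1]$) be given. For each $\mathcal{S}\in\mathcal{PO}^\alpha_2$ there exists $\lambda\in(0,1)$ such that $\mathcal{S}$ is a maximum $\lambda$-cent-dian.
   Context: Setting. $\mathcal{N}=(N,E)$ is a finite undirected graph with node costs $b_i\ge 0$ ($i\in N$) and edge costs $c_e\ge 0$ ($e\in E$). Each edge $\{i,j\}\in E$ gives two arcs $(i,j)$ and $(j,i)$; each arc $a$ has a length $d_a\ge 0$. $W\subset N\times N$ is a finite nonempty set of origin/destination pairs $w=(w^s,w^t)$ with $w^s\ne w^t$; each $w\in W$ has a demand $g^w>0$ and a private utility $u^w>0$. Put $G=\sum_{w\in W}g^w$. Feasible subgraphs. For $\alpha\in[0,1]$, $\mathcal{N}^\alpha$ is the set of all subgraphs $\mathcal{S}=(N_{\mathcal S},E_{\mathcal S})$ of $\mathcal N$ (the empty subgraph is allowed) with $\sum_{i\in N_{\mathcal S}}b_i+\sum_{e\in E_{\mathcal S}}c_e\le \alpha\big(\sum_{i\in N}b_i+\sum_{e\in E}c_e\big)$. Lengths. For a subgraph $\mathcal S$ and $w\in W$, $d_{\mathcal S}(w)$ is the length of a shortest path from $w^s$ to $w^t$ using arcs arising from edges of $\mathcal S$, with $d_{\mathcal S}(w)=+\infty$ if no such path exists in $\mathcal{S}$; and $\ell_{\mathcal S}(w)=\min\{d_{\mathcal S}(w),u^w\}$. Objectives. $F_m(\mathcal S)=\frac1G\sum_{w\in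 W}g^w\ell_{\mathcal S}(w)$, $F_c(\mathcal S)=\max_{w\in W}\ell_{\mathcal S}(w)$, $H_\lambda(\mathcal S)=\lambda F_c(\mathcal S)+(1-\lambda)F_m(\mathcal S)$, and $\bar H_\lambda(\mathcal S)=\max\{\lambda F_c(\mathcal S),(1-\lambda)F_m(\mathcal S)\}$. Maximum $\lambda$-cent-dian. A subgraph $\mathcal S\in\mathcal N^\alpha$ is a maximum $\lambda$-cent-dian if it is an optimal solution of $\operatorname{lex}\min\{[\bar H_\lambda(\mathcal S),H_\lambda(\mathcal S)]:\mathcal S\in\mathcal N^\alpha\}$, i.e. it minimizes $H_\lambda$ among all minimizers of $\bar H_\lambda$ over $\mathcal N^\alpha$. Pareto-optimality. $\mathcal{PO}^\alpha_2$ is the set of all $\mathcal S\in\mathcal N^\alpha$ for which there is no $\mathcal S'\in\mathcal N^\alpha$ with $F_m(\mathcal S')\le F_m(\mathcal S)$ and $F_c(\mathcal S')\le F_c(\mathcal S)$, at least one of the two inequalities being strict. *)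

theory Defs
  imports Complex_Main "HOL-Library.Extended_Real"
begin

text \<open>
  Undirected edges are two-element sets of nodes; the arcs arising from an edge \<open>{i, j}\<close> are the
  pairs \<open>(i, j)\<close> and \<open>(j, i)\<close>, whose lengths may differ.
\<close>

record 'v instance_data =
  nodes :: "'v set"
  edges :: "'v set set"
  node_cost :: "'v \<Rightarrow> real"
  edge_cost :: "'v set \<Rightarrow> real"
  arc_length :: "'v \<times> 'v \<Rightarrow> real"
  od_pairs :: "('v \<times> 'v) set"
  demand :: "'v \<times> 'v \<Rightarrow> real"
  utility :: "'v \<times> 'v \<Rightarrow> real"

locale network_design =
  fixes I :: "'v instance_data"
  assumes finite_nodes: "finite (nodes I)"
    and edges: "e \<in> edges I \<Longrightarrow> \<exists>i\<in>nodes I. \<exists>j\<in>nodes I. i \<noteq> j \<and> e = {i, j}"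
    and node_cost_nonneg: "i \<in> nodes I \<Longrightarrow> 0 \<le> node_cost I i"
    and edge_cost_nonneg: "e \<in> edges I \<Longrightarrow> 0 \<le> edge_cost I e"
    and arc_length_nonneg: "{i, j} \<in> edges I \<Longrightarrow> 0 \<le> arc_length I (i, j)"
    and finite_od_pairs: "finite (od_pairs I)"
    and od_pairs_nonempty: "od_pairs I \<noteq> {}"
    and od_pairs_nodes: "od_pairs I \<subseteq> nodes I \<times> nodes I"
    and od_pairs_distinct: "w \<in> od_pairs I \<Longrightarrow> fst w \<noteq> snd w"
    and demand_pos: "w \<in> od_pairs I \<Longrightarrow> 0 < demand I w"
    and utility_pos: "w \<in> od_pairs I \<Longrightarrow> 0 < utility I w"

type_synonym 'v subgraph = "'v set \<times> 'v set set"

definition is_subgraph :: "'v instance_data \<Rightarrow> 'v subgraph \<Rightarrow> bool" where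
  "is_subgraph I S \<longleftrightarrow> fst S \<subseteq> nodes I \<and> snd S \<subseteq> edges I \<and> (\<forall>e\<in>snd S. e \<subseteq> fst S)"

definition cost :: "'v instance_data \<Rightarrow> 'v subgraph \<Rightarrow> real" where
  "cost I S = (\<Sum>i\<in>fst S. node_cost I i) + (\<Sum>e\<in>snd S. edge_cost I e)"

definition feasible :: "'v instance_data \<Rightarrow> real \<Rightarrow> 'v subgraph set" where
  "feasible I \<alpha> = {S. is_subgraph I S \<and> cost I S \<le> \<alpha> * cost I (nodes I, edges I)}"

definition is_path :: "'v subgraph \<Rightarrow> 'v \<times> 'v \<Rightarrow> 'v list \<Rightarrow> bool" where
  "is_path S w p \<longleftrightarrow> p \<noteq> [] \<and> hd p = fst w \<and> last p = snd w \<and> distinct p \<and>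
     successively (\<lambda>i j. {i, j} \<in> snd S) p"

definition path_length :: "'v instance_data \<Rightarrow> 'v list \<Rightarrow> real" where
  "path_length I p = (\<Sum>a\<leftarrow>zip p (tl p). arc_length I a)"

text \<open>
  The infimum over no paths is \<open>\<infinity>\<close>. In a finite graph there are finitely many paths, so otherwise
  the infimum is attained by a shortest path.
\<close>

definition dist_in :: "'v instance_data \<Rightarrow> 'v subgraph \<Rightarrow> 'v \<times> 'v \<Rightarrow> ereal" where
  "dist_in I S w = (INF p\<in>{p. is_path S w p}. ereal (path_length I p))"

text \<open>The minimum below is never infinite, so the conversion to \<^typ>\<open>real\<close> loses nothing.\<close>

definition travel_length :: "'v instance_data \<Rightarrow> 'v subgraph \<Rightarrow> 'v \<times> 'v \<Rightarrow> real" where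
  "travel_length I S w = real_of_ereal (min (dist_in I S w) (ereal (utility I w)))"

definition total_demand :: "'v instance_data \<Rightarrow> real" where
  "total_demand I = (\<Sum>w\<in>od_pairs I. demand I w)"

definition F_m :: "'v instance_data \<Rightarrow> 'v subgraph \<Rightarrow> real" where
  "F_m I S = 1 / total_demand I * (\<Sum>w\<in>od_pairs I. demand I w * travel_length I S w)"

definition F_c :: "'v instance_data \<Rightarrow> 'v subgraph \<Rightarrow> real" where
  "F_c I S = (MAX w\<in>od_pairs I. travel_length I S w)"

definition H :: "'v instance_data \<Rightarrow> real \<Rightarrow> 'v subgraph \<Rightarrow> real" where
  "H I l S = l * F_c I S + (1 - l) * F_m I S"

definition H_bar :: "'v instance_data \<Rightarrow> real \<Rightarrow> 'v subgraph \<Rightarrow> real" where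
  "H_bar I l S = max (l * F_c I S) ((1 - l) * F_m I S)"

definition max_cent_dian :: "'v instance_data \<Rightarrow> real \<Rightarrow> real \<Rightarrow> 'v subgraph \<Rightarrow> bool" where
  "max_cent_dian I \<alpha> l S \<longleftrightarrow>
     is_arg_min (H I l) (is_arg_min (H_bar I l) (\<lambda>S'. S' \<in> feasible I \<alpha>)) S"

definition pareto_2 :: "'v instance_data \<Rightarrow> real \<Rightarrow> 'v subgraph set" where
  "pareto_2 I \<alpha> = {S \<in> feasible I \<alpha>. \<not> (\<exists>S'\<in>feasible I \<alpha>.
     F_m I S' \<le> F_m I S \<and> F_c I S' \<le> F_c I S \<and> (F_m I S' < F_m I S \<or> F_c I S' < F_c I S))}"

end

theory Submission
  imports Defs
begin

text \<open>
  The weight \<open>l\<close> is chosen to balance the two terms of \<open>H_bar\<close> at \<open>S\<close>, that is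
  \<open>l * F_c I S = (1 - l) * F_m I S\<close>. Their maximum is then equal to each of them, so a competitor
  whose \<open>H_bar\<close> is no larger has neither a larger \<open>F_c\<close> nor a larger \<open>F_m\<close>, and Pareto-optimality
  forces it to agree with \<open>S\<close> in both. Hence \<open>S\<close> minimizes \<open>H_bar\<close>, and \<open>H\<close> is constant on the
  minimizers, so \<open>S\<close> is also optimal at the second level (\<open>balanced_pareto_is_max_cent_dian\<close>).

  A balancing weight strictly between 0 and 1 exists if both objectives are positive at \<open>S\<close>, or
  both are zero (\<open>ex_balancing_weight\<close>). Arcs of length zero allow the second case. One objective
  cannot vanish without the other: demands are positive and travel lengths nonnegative, so each
  objective vanishes exactly when all travel lengths do.
\<close>

lemma ex_balancing_weight:
  fixes x y :: real
  assumes "0 \<le> x" "0 \<le> y" "x = 0 \<longleftrightarrow> y = 0"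
  shows "\<exists>l. 0 < l \<and> l < 1 \<and> l * x = (1 - l) * y"
proof (cases "x = 0")
  case True
  then show ?thesis
    using assms by (intro exI[of _ "1/2"]) simp
next
  case False
  then have "0 < x" "0 < y"
    using assms by auto
  then show ?thesis
    by (intro exI[of _ "y / (x + y)"]) (simp add: field_simps)
qed

text \<open>
  At a balanced \<open>S\<close> the sublevel set of \<open>H_bar\<close> consists of the subgraphs that are at least as good
  as \<open>S\<close> in both objectives. If \<open>S\<close> is Pareto-optimal, the feasible ones share its two values.
\<close>

lemma balanced_pareto_is_max_cent_dian:
  assumes pareto: "S \<in> pareto_2 I \<alpha>"
    and l: "0 < l" "l < 1"
    and balanced: "l * F_c I S = (1 - l) * F_m I S"
  shows "max_cent_dian I \<alpha> l S"
proof -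
  have feas: "S \<in> feasible I \<alpha>"
    using pareto by (simp add: pareto_2_def)
  have same: "F_c I S' = F_c I S \<and> F_m I S' = F_m I S"
    if S': "S' \<in> feasible I \<alpha>" and le: "H_bar I l S' \<le> H_bar I l S" for S'
  proof -
    have "l * F_c I S' \<le> l * F_c I S" "(1 - l) * F_m I S' \<le> (1 - l) * F_m I S"
      using le balanced by (simp_all add: H_bar_def)
    then have "F_c I S' \<le> F_c I S" "F_m I S' \<le> F_m I S"
      using l by simp_all
    then show ?thesis
      using pareto S' unfolding pareto_2_def by force
  qed
  have "is_arg_min (H_bar I l) (\<lambda>S'. S' \<in> feasible I \<alpha>) S"
    unfolding is_arg_min_def
  proof (intro conjI feas notI)
    assume "\<exists>S'. S' \<in> feasible I \<alpha> \<and> H_bar I l S' < H_bar I l S"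
    then obtain S' where S': "S' \<in> feasible I \<alpha>" "H_bar I l S' < H_bar I l S"
      by blast
    have "H_bar I l S' = H_bar I l S"
      unfolding H_bar_def using same[OF S'(1) less_imp_le[OF S'(2)]] by simp
    with S' show False
      by simp
  qed
  moreover have "H I l S' = H I l S"
    if "is_arg_min (H_bar I l) (\<lambda>S'. S' \<in> feasible I \<alpha>) S'" for S'
  proof -
    have "S' \<in> feasible I \<alpha>" "H_bar I l S' \<le> H_bar I l S"
      using that feas unfolding is_arg_min_linorder by blast+
    then show ?thesis
      by (simp add: H_def same)
  qed
  ultimately show ?thesis
    unfolding max_cent_dian_def is_arg_min_def[of "H I l"] by fastforce
qed

context network_design
begin

lemma path_length_nonneg:
  assumes "snd S \<subseteq> edges I" "successively (\<lambda>i j. {i, j} \<in> snd S) p"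
  shows "0 \<le> path_length I p"
  using assms(2)
proof (induction p rule: induct_list012)
  case (3 i j p)
  then have "0 \<le> arc_length I (i, j)"
    using assms(1) arc_length_nonneg by auto
  with 3 show ?case
    by (simp add: path_length_def)
qed (simp_all add: path_length_def)

lemma travel_length_nonneg:
  assumes "is_subgraph I S" "w \<in> od_pairs I"
  shows "0 \<le> travel_length I S w"
proof -
  have "0 \<le> dist_in I S w"
    unfolding dist_in_def
    using assms(1) path_length_nonneg
    by (intro INF_greatest) (auto simp: is_subgraph_def is_path_def)
  then show ?thesis
    unfolding travel_length_def
    using utility_pos[OF assms(2)] by (intro real_of_ereal_pos) simp
qed

lemma total_demand_pos: "0 < total_demand I"
  unfolding total_demand_def
  using finite_od_pairs od_pairs_nonempty demand_pos by (rule sum_pos)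

lemma F_m_nonneg:
  assumes "is_subgraph I S"
  shows "0 \<le> F_m I S"
  unfolding F_m_def
  using assms total_demand_pos demand_pos travel_length_nonneg
  by (intro mult_nonneg_nonneg sum_nonneg) (auto intro: less_imp_le)

lemma F_c_nonneg:
  assumes "is_subgraph I S"
  shows "0 \<le> F_c I S"
  unfolding F_c_def
  using assms finite_od_pairs od_pairs_nonempty travel_length_nonneg
  by (subst Max_ge_iff) auto

lemma F_m_eq_0_iff:
  assumes "is_subgraph I S"
  shows "F_m I S = 0 \<longleftrightarrow> (\<forall>w\<in>od_pairs I. travel_length I S w = 0)"
proof -
  have "F_m I S = 0 \<longleftrightarrow> (\<Sum>w\<in>od_pairs I. demand I w * travel_length I S w) = 0"
    using total_demand_pos by (simp add: F_m_def)
  also have "\<dots> \<longleftrightarrow> (\<forall>w\<in>od_pairs I. demand I w * travel_length I S w = 0)"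
    using finite_od_pairs
    by (intro sum_nonneg_eq_0_iff)
      (simp_all add: demand_pos less_imp_le travel_length_nonneg[OF assms])
  also have "\<dots> \<longleftrightarrow> (\<forall>w\<in>od_pairs I. travel_length I S w = 0)"
    using demand_pos by fastforce
  finally show ?thesis .
qed

lemma F_c_eq_0_iff:
  assumes "is_subgraph I S"
  shows "F_c I S = 0 \<longleftrightarrow> (\<forall>w\<in>od_pairs I. travel_length I S w = 0)"
proof -
  have "F_c I S = 0 \<longleftrightarrow> F_c I S \<le> 0"
    using F_c_nonneg[OF assms] by auto
  also have "\<dots> \<longleftrightarrow> (\<forall>w\<in>od_pairs I. travel_length I S w \<le> 0)"
    unfolding F_c_def using finite_od_pairs od_pairs_nonempty by (subst Max_le_iff) auto
  also have "\<dots> \<longleftrightarrow> (\<forall>w\<in>od_pairs I. travel_length I S w = 0)"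
    using travel_length_nonneg[OF assms] by (auto intro: antisym)
  finally show ?thesis .
qed

end

theorem proposition5:
  fixes I :: "'v instance_data" and \<alpha> :: real and S :: "'v subgraph"
  assumes "network_design I"
    and "0 \<le> \<alpha>" and "\<alpha> \<le> 1"
    and "S \<in> pareto_2 I \<alpha>"
  shows "\<exists>l. 0 < l \<and> l < 1 \<and> max_cent_dian I \<alpha> l S"
proof -
  interpret network_design I by fact
  have S: "is_subgraph I S"
    using assms(4) by (simp add: pareto_2_def feasible_def)
  have "\<exists>l. 0 < l \<and> l < 1 \<and> l * F_c I S = (1 - l) * F_m I S"
    using F_c_nonneg[OF S] F_m_nonneg[OF S] F_c_eq_0_iff[OF S] F_m_eq_0_iff[OF S]
    by (intro ex_balancing_weight) auto
  then show ?thesis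
    using balanced_pareto_is_max_cent_dian[OF assms(4)] by blast
qed

end
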